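(* Let $s=\sigma+it$ with $\sigma,t$ real, $\sigma\ge2$ and $t>16\pi$. Then $$|\mathcal{R}(s)-1|\le \frac{3}{2^\sigma}+\Bigl(\frac{2\pi}{t}\Bigr)^{\min(\sigma,1)/2}.$$
   Context: $\mathcal{R}(s)$ is Riemann's auxiliary function, the entire function defined for all $s\in\mathbf{C}$ by $$\mathcal{R}(s)=\int_{L}\frac{x^{-s}e^{\pi i x^2}}{e^{\pi i x}-e^{-\pi i x}}\,dx,$$ where $L$ is the straight line through a point $c$ of the real interval $(0,1)$ (the value does not depend on $c$) parallel to the bisector of the first quadrant, i.e. $\{c+ue^{\pi i/4}:u\in\mathbf{R}\}$, traversed from upper right to lower left ($u$ decreasing from $+\infty$ to $-\infty$), and $x^{-s}=\exp(-s\log x)$ with the principal branch of $\log$. *)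

theory Defs
  imports "HOL-Complex_Analysis.Complex_Analysis"
begin

definition aux_integrand :: "complex \<Rightarrow> complex \<Rightarrow> complex" where
  "aux_integrand s x =
     x powr (- s) * exp (of_real pi * \<i> * x\<^sup>2) /
       (exp (of_real pi * \<i> * x) - exp (- (of_real pi * \<i> * x)))"

definition aux_line :: "real \<Rightarrow> real \<Rightarrow> complex" where
  "aux_line c u = of_real c + of_real u * exp (\<i> * of_real (pi / 4))"

(* The crossing point c of the line with the real axis is kept as a parameter, meant to satisfy
   0 < c < 1; such a line avoids the integers and the branch cut of the power, and the integrand
   decays like exp (- pi * u^2) along it (up to exp (O (|u|)) factors), so the integral converges
   absolutely. The bounds run from +infinity down to -infinity, i.e. from the upper right to the
   lower left; the last factor is the derivative of the parametrisation. *)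
definition riemann_aux :: "real \<Rightarrow> complex \<Rightarrow> complex" where
  "riemann_aux c s =
     (LBINT u=\<infinity>..-\<infinity>. aux_integrand s (aux_line c u) * exp (\<i> * of_real (pi / 4)))"

end

theory Submission
  imports Defs "HOL-Probability.Probability" "HOL-Real_Asymp.Real_Asymp"
begin

text \<open>
Let $\xi = \sqrt{t / 2 \pi}$, the saddle point of $x^{-it} e^{\pi i x^2}$. Moving the line of
integration to the right up to a half-integer $b$ near $\xi$ produces the residues $n^{-s}$ for
$n < b$; those with $n \ge 2$ contribute at most $3 / 2^\sigma$. On the line through $b$, with
$x = b + v (1 + i)$ and $w = v / b$, the modulus of $x^{-it} e^{\pi i x^2}$ is
$\exp (2 \pi \xi^2 \arg (1 + w + i w) - 2 \pi b^2 (w + w^2))$, and since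
$\frac{d}{dw} \arg (1 + w + i w) = 1 / (1 + 2 w + 2 w^2)$ this is dominated by a Gaussian in $v$.
The denominator has modulus at least $\frac{\sqrt 3}{2} e^{\pi |v|}$ there, which absorbs half of the linear
term caused by $b \ne \xi$. The resulting Gaussian integrals add up to less than $1 / \xi$.
\<close>

section \<open>The residue theorem on a horizontal strip\<close>

text \<open>For \<sigma> \<ge> 2 the last term of the bound is 1 / \<xi>, while the shifted line
  yields a constant over b^2, because |x| \<ge> 1 there and so |x|^(-\<sigma>) \<le> |x|^(-2).
  Everything comes down to b outweighing that constant. The obstacle is the distance of up to 1/2
  between b and \<xi>: it leaves a linear term 2 pi (\<xi>^2 - b^2) v / b of slope up to 2.2 pi in
  absolute value. Its sign decides which one-sided exponential should replace exp (- pi |v|), hence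
  separate estimates for \<xi> on either side of b. For b \<le> \<xi> the constant stays below 1.7.
  For \<xi> < b the factor |x|^(-2) can double on the side where no decay is left to pay for it, and
  the constant rises to about 3.3. The hypothesis t > 16 pi gives \<xi> > 2.8, so b = 5/2 occurs
  only in the favourable case, and the other one starts at b = 7/2.\<close>

lemma contour_integral_linepath_same_Im:
  assumes "a < b"
  shows "contour_integral (linepath (Complex a y) (Complex b y)) f =
         integral {a..b} (\<lambda>x. f (Complex x y))"
proof -
  have "contour_integral (linepath (Complex a y) (Complex b y)) f =
        contour_integral (linepath (of_real a) (of_real b)) (\<lambda>z. f (z + \<i> * of_real y))"
  proof -
    have *: "linepath (Complex a y) (Complex b y) x =
             linepath (complex_of_real a) (of_real b) x + \<i> * of_real y" for x
      by (auto simp: linepath_def complex_eq_iff algebra_simps)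
    have **: "Complex b y - Complex a y = complex_of_real b - of_real a"
      by (simp add: complex_eq_iff)
    show ?thesis
      unfolding contour_integral_def contour_integrable_on_def has_contour_integral_linepath * ** ..
  qed
  also have "\<dots> = integral {a..b} (\<lambda>x. f (of_real x + \<i> * of_real y))"
    using assms by (subst contour_integral_linepath_Reals_eq) auto
  finally show ?thesis
    by (simp add: Complex_eq)
qed

lemma integral_symmetric_interval_tendsto:
  fixes f :: "real \<Rightarrow> complex"
  assumes "integrable lborel f"
  shows "(\<lambda>n. integral {- real (Suc n)..real (Suc n)} f) \<longlonglongrightarrow> (LINT x|lborel. f x)"
proof -
  let ?A = "\<lambda>n. {- real (Suc n)..real (Suc n)}"
  have "\<exists>n. x \<in> ?A n" for x
  proof -
    obtain n where "\<bar>x\<bar> \<le> real n"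
      using real_arch_simple by blast
    then show ?thesis
      by (intro exI[of _ n]) auto
  qed
  then have U: "(\<Union>n. ?A n) = UNIV"
    by blast
  have "(\<lambda>n. LINT x:?A n|lborel. f x) \<longlonglongrightarrow> (LINT x:(\<Union>n. ?A n)|lborel. f x)"
    using assms by (intro set_integral_cont_up) (simp_all only: U, auto simp: incseq_def set_integrable_def)
  moreover have "(LINT x:?A n|lborel. f x) = integral (?A n) f" for n
    using assms
    by (intro set_borel_integral_eq_integral)
       (auto simp: set_integrable_def intro: integrable_mult_indicator)
  moreover have "(LINT x:(\<Union>n. ?A n)|lborel. f x) = (LINT x|lborel. f x)"
    by (simp only: U set_lebesgue_integral_def) simp
  ultimately show ?thesis
    by simp
qed

text \<open>Rectangles whose vertical sides go to infinity: the majorant \<open>e\<close> is uniform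
  in the height, so these sides vanish in the limit. The lower edge is traversed from left to right,
  which fixes the sign. The margins \<open>a'\<close> and \<open>b'\<close> put the closed strip
  inside an open set of holomorphy.\<close>

theorem residue_theorem_horizontal_strip:
  fixes G :: "complex \<Rightarrow> complex"
  assumes "a < b" "a' < a" "b < b'" "finite P"
    and P: "\<And>z. z \<in> P \<Longrightarrow> a < Im z \<and> Im z < b"
    and holo: "G holomorphic_on {z. a' < Im z \<and> Im z < b'} - P"
    and int_a: "integrable lborel (\<lambda>x. G (Complex x a))"
    and int_b: "integrable lborel (\<lambda>x. G (Complex x b))"
    and decay: "\<And>x y. C \<le> \<bar>x\<bar> \<Longrightarrow> a \<le> y \<Longrightarrow> y \<le> b \<Longrightarrow> norm (G (Complex x y)) \<le> e x"
    and e0: "(e \<longlongrightarrow> 0) at_top" "(e \<longlongrightarrow> 0) at_bot"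
  shows "(LINT x|lborel. G (Complex x a)) - (LINT x|lborel. G (Complex x b)) =
         2 * pi * \<i> * (\<Sum>p\<in>P. residue G p)"
proof -
  define S where "S = {z. a' < Im z \<and> Im z < b'}"
  have S_eq: "S = {z. a' < Im z} \<inter> {z. Im z < b'}"
    by (auto simp: S_def)
  have "open S"
    unfolding S_eq by (intro open_Int open_halfspace_Im_gt open_halfspace_Im_lt)
  have "convex S"
    unfolding S_eq by (intro convex_Int convex_halfspace_Im_gt convex_halfspace_Im_lt)
  have cont: "G contour_integrable_on linepath p q"
    if "closed_segment p q \<subseteq> S - P" for p q
    using that holo holomorphic_on_subset
    unfolding S_def[symmetric]
    by (intro contour_integrable_holomorphic_simple[of G "S - P"])
       (auto intro!: open_Diff \<open>open S\<close> finite_imp_closed \<open>finite P\<close>)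
  obtain K where K: "\<And>z. z \<in> P \<Longrightarrow> norm z \<le> K"
    using finite_imp_bounded[OF \<open>finite P\<close>] by (auto simp: bounded_iff)
  \<comment> \<open>\<open>Suc\<close> keeps the rectangle nondegenerate for every index, including
    0.\<close>
  define T :: "nat \<Rightarrow> real" where "T n = real (Suc n)" for n
  have Tpos: "T n > 0" for n
    by (simp add: T_def)
  define R where "R n = contour_integral (linepath (Complex (T n) a) (Complex (T n) b)) G" for n
  define L where "L n = contour_integral (linepath (Complex (- T n) b) (Complex (- T n) a)) G" for n
  have vert: "closed_segment (Complex x y) (Complex x y') \<subseteq> {z. Re z = x \<and> a \<le> Im z \<and> Im z \<le> b}"
    if "y \<in> {a..b}" "y' \<in> {a..b}" for x y y'
    using that by (subst closed_segment_same_Re) (auto simp: closed_segment_eq_real_ivl split: if_splits)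
  have ev: "eventually (\<lambda>n. T n > K \<and> T n > C) sequentially"
    unfolding T_def by (intro eventually_conj; real_asymp)
  have main: "integral {- T n..T n} (\<lambda>x. G (Complex x a)) + R n
        - integral {- T n..T n} (\<lambda>x. G (Complex x b)) + L n =
        2 * pi * \<i> * (\<Sum>p\<in>P. residue G p)" if "T n > K" for n
  proof -
    let ?r = "rectpath (Complex (- T n) a) (Complex (T n) b)"
    have box: "p \<in> box (Complex (- T n) a) (Complex (T n) b)" if "p \<in> P" for p
      using K[OF that] P[OF that] abs_Re_le_cmod[of p] \<open>T n > K\<close>
      by (auto simp: in_box_complex_iff)
    have img: "path_image ?r \<subseteq> S - P"
    proof
      fix z assume z: "z \<in> path_image ?r"
      then have z': "\<bar>Re z\<bar> = T n \<and> Im z \<in> {a..b} \<or> Im z \<in> {a, b}"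
        using Tpos[of n] \<open>a < b\<close> by (subst (asm) path_image_rectpath) auto
      then have "z \<in> S"
        using assms(1-3) by (auto simp: S_def)
      moreover have "z \<notin> P"
        using z' K[of z] P[of z] \<open>T n > K\<close> abs_Re_le_cmod[of z] by auto
      ultimately show "z \<in> S - P" by blast
    qed
    have sub: "closed_segment (Complex (- T n) a) (Complex (T n) a) \<subseteq> S - P"
       "closed_segment (Complex (T n) a) (Complex (T n) b) \<subseteq> S - P"
       "closed_segment (Complex (T n) b) (Complex (- T n) b) \<subseteq> S - P"
       "closed_segment (Complex (- T n) b) (Complex (- T n) a) \<subseteq> S - P"
      using img by (auto simp: rectpath_def Let_def path_image_join)
    note ci = sub[THEN cont]
    have "contour_integral ?r G =
        2 * pi * \<i> * (\<Sum>p\<in>P. winding_number ?r p * residue G p)"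
    proof (rule Residue_theorem[OF \<open>open S\<close> _ \<open>finite P\<close>])
      show "connected S"
        using \<open>convex S\<close> convex_connected by blast
      show "\<forall>z. z \<notin> S \<longrightarrow> winding_number ?r z = 0"
        using Tpos[of n] assms(1-3)
        by (intro allI impI winding_number_rectpath_outside) (auto simp: S_def in_cbox_complex_iff)
    qed (use holo img in \<open>auto simp: S_def\<close>)
    also have "(\<Sum>p\<in>P. winding_number ?r p * residue G p) = (\<Sum>p\<in>P. residue G p)"
      by (intro sum.cong) (auto simp: winding_number_rectpath box)
    also have "contour_integral ?r G =
       contour_integral (linepath (Complex (- T n) a) (Complex (T n) a)) G + (R n +
       (contour_integral (linepath (Complex (T n) b) (Complex (- T n) b)) G + L n))"
      unfolding rectpath_def Let_def R_def L_def using ci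
      by (simp add: contour_integral_join contour_integrable_joinI)
    also have "contour_integral (linepath (Complex (T n) b) (Complex (- T n) b)) G =
      - contour_integral (linepath (Complex (- T n) b) (Complex (T n) b)) G"
      using contour_integral_reverse_linepath[of "Complex (- T n) b" "Complex (T n) b" G]
        continuous_on_subset[OF holomorphic_on_imp_continuous_on[OF holo]] sub(3)
      by (simp add: S_def closed_segment_commute)
    finally show ?thesis
      using Tpos[of n] by (simp add: contour_integral_linepath_same_Im algebra_simps)
  qed
  have e_nonneg: "0 \<le> e x" if "C \<le> \<bar>x\<bar>" for x
    using decay[OF that, of a] norm_ge_zero[of "G (Complex x a)"] \<open>a < b\<close> by linarith
  have R0: "R \<longlonglongrightarrow> 0"
  proof (rule Lim_null_comparison)
    show "eventually (\<lambda>n. norm (R n) \<le> e (T n) * (b - a)) sequentially"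
      using ev
    proof eventually_elim
      case (elim n)
      have seg: "closed_segment (Complex (T n) a) (Complex (T n) b) \<subseteq>
          {z. Re z = T n \<and> a \<le> Im z \<and> Im z \<le> b}"
        using \<open>a < b\<close> by (intro vert) auto
      have "z \<in> S - P" if "Re z = T n" "a \<le> Im z" "Im z \<le> b" for z
        using K[of z] abs_Re_le_cmod[of z] elim that assms(1-3) by (auto simp: S_def)
      with seg have "closed_segment (Complex (T n) a) (Complex (T n) b) \<subseteq> S - P"
        by blast
      moreover have "norm (G z) \<le> e (T n)" if "Re z = T n" "a \<le> Im z" "Im z \<le> b" for z
        using decay[of "T n" "Im z"] elim Tpos[of n] that by (cases z) auto
      ultimately have "norm (R n) \<le> e (T n) * norm (Complex (T n) b - Complex (T n) a)"
        unfolding R_def using seg e_nonneg[of "T n"] elim Tpos[of n]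
        by (intro contour_integral_bound_linepath cont) auto
      then show ?case
        using \<open>a < b\<close> by (simp add: cmod_def)
    qed
    have "(\<lambda>n. e (T n)) \<longlonglongrightarrow> 0"
      by (rule filterlim_compose[OF e0(1)]) (unfold T_def, real_asymp)
    then show "(\<lambda>n. e (T n) * (b - a)) \<longlonglongrightarrow> 0"
      by (intro tendsto_mult_left_zero)
  qed
  have L0: "L \<longlonglongrightarrow> 0"
  proof (rule Lim_null_comparison)
    show "eventually (\<lambda>n. norm (L n) \<le> e (- T n) * (b - a)) sequentially"
      using ev
    proof eventually_elim
      case (elim n)
      have seg: "closed_segment (Complex (- T n) b) (Complex (- T n) a) \<subseteq>
          {z. Re z = - T n \<and> a \<le> Im z \<and> Im z \<le> b}"
        using \<open>a < b\<close> by (intro vert) auto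
      have "z \<in> S - P" if "Re z = - T n" "a \<le> Im z" "Im z \<le> b" for z
        using K[of z] abs_Re_le_cmod[of z] elim that assms(1-3) by (auto simp: S_def)
      with seg have "closed_segment (Complex (- T n) b) (Complex (- T n) a) \<subseteq> S - P"
        by blast
      moreover have "norm (G z) \<le> e (- T n)" if "Re z = - T n" "a \<le> Im z" "Im z \<le> b" for z
        using decay[of "- T n" "Im z"] elim Tpos[of n] that by (cases z) auto
      ultimately have "norm (L n) \<le> e (- T n) * norm (Complex (- T n) a - Complex (- T n) b)"
        unfolding L_def using seg e_nonneg[of "- T n"] elim Tpos[of n]
        by (intro contour_integral_bound_linepath cont) auto
      then show ?case
        using \<open>a < b\<close> by (simp add: cmod_def)
    qed
    have "(\<lambda>n. e (- T n)) \<longlonglongrightarrow> 0"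
      by (rule filterlim_compose[OF e0(2)]) (unfold T_def, real_asymp)
    then show "(\<lambda>n. e (- T n) * (b - a)) \<longlonglongrightarrow> 0"
      by (intro tendsto_mult_left_zero)
  qed
  have "(\<lambda>n. integral {- T n..T n} (\<lambda>x. G (Complex x a)) + R n
        - integral {- T n..T n} (\<lambda>x. G (Complex x b)) + L n) \<longlonglongrightarrow>
        (LINT x|lborel. G (Complex x a)) + 0 - (LINT x|lborel. G (Complex x b)) + 0"
    unfolding T_def
    by (intro tendsto_intros integral_symmetric_interval_tendsto int_a int_b R0 L0)
  moreover have "(\<lambda>n. integral {- T n..T n} (\<lambda>x. G (Complex x a)) + R n
        - integral {- T n..T n} (\<lambda>x. G (Complex x b)) + L n) \<longlonglongrightarrow>
        2 * pi * \<i> * (\<Sum>p\<in>P. residue G p)"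
    by (rule tendsto_eventually) (use ev main in \<open>auto elim: eventually_mono\<close>)
  ultimately show ?thesis
    using LIMSEQ_unique by fastforce
qed

section \<open>The integrand on a half-integer line\<close>

lemma Im_Ln_diagonal_deriv:
  fixes w :: real
  shows "((\<lambda>w. Im (Ln (Complex (1 + w) w))) has_real_derivative 1 / (1 + 2 * w + 2 * w\<^sup>2)) (at w)"
proof -
  \<comment> \<open>The imaginary part vanishes only for w = 0, where the point is 1; the diagonal
    never meets the branch cut.\<close>
  have nz: "Complex (1 + w) w \<notin> \<real>\<^sub>\<le>\<^sub>0"
    by (auto simp: complex_nonpos_Reals_iff)
  have "((\<lambda>z. Ln (1 + z * Complex 1 1)) has_field_derivative
          inverse (1 + of_real w * Complex 1 1) * Complex 1 1) (at (of_real w))"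
    using nz by (auto intro!: derivative_eq_intros simp: complex_nonpos_Reals_iff)
  then have "((\<lambda>x. Ln (1 + of_real x * Complex 1 1)) has_vector_derivative
          inverse (1 + of_real w * Complex 1 1) * Complex 1 1) (at w)"
    by (rule has_vector_derivative_real_field)
  then have "((\<lambda>x. Im (Ln (1 + of_real x * Complex 1 1))) has_real_derivative
          Im (inverse (1 + of_real w * Complex 1 1) * Complex 1 1)) (at w)"
    by (rule has_field_derivative_Im)
  moreover have "1 + of_real x * Complex 1 1 = Complex (1 + x) x" for x
    by (simp add: complex_eq_iff)
  moreover have "Im (inverse (Complex (1 + w) w) * Complex 1 1) = 1 / (1 + 2 * w + 2 * w\<^sup>2)"
    by (simp add: power2_eq_square algebra_simps flip: add_divide_distrib diff_divide_distrib)
  ultimately show ?thesis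
    by simp
qed

text \<open>The difference of the two sides vanishes at 0 and has derivative - x q(x), where the
  numerator of q is the quadratic in the hypothesis; so it decreases away from 0 in both directions.
  The Taylor expansion w - w^2 + ... corresponds to k = 2, and smaller k trades sharpness for a
  larger range of w.\<close>

lemma Im_Ln_diagonal_le:
  fixes w k :: real
  assumes pos: "\<And>x. x \<in> closed_segment 0 w \<Longrightarrow> 0 \<le> (4 - 2 * k) + (6 - 4 * k) * x + 4 * (1 - k) * x\<^sup>2"
  shows "Im (Ln (Complex (1 + w) w)) \<le> w + (1 - k) * w\<^sup>2"
proof -
  define h where "h w = Im (Ln (Complex (1 + w) w)) - (w + (1 - k) * w\<^sup>2)" for w
  define q where "q x = ((4 - 2 * k) + (6 - 4 * k) * x + 4 * (1 - k) * x\<^sup>2) / (1 + 2 * x + 2 * x\<^sup>2)"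
    for x :: real
  have D: "1 + 2 * x + 2 * x\<^sup>2 > 0" for x :: real
  proof -
    have "1 + 2 * x + 2 * x\<^sup>2 = (1 + x)\<^sup>2 + x\<^sup>2"
      by (simp add: power2_eq_square algebra_simps)
    then show ?thesis
      by (metis add_cancel_left_right add_pos_nonneg not_sum_power2_lt_zero
          linorder_neqE_linordered_idom sum_power2_eq_zero_iff zero_neq_one add.commute)
  qed
  have deriv: "(h has_real_derivative (- x * q x)) (at x)" for x
  proof -
    have *: "((\<lambda>w. w + (1 - k) * w\<^sup>2) has_real_derivative (1 + (1 - k) * (2 * x))) (at x)"
      by (auto intro!: derivative_eq_intros)
    have "- x * q x = 1 / (1 + 2 * x + 2 * x\<^sup>2) - (1 + (1 - k) * (2 * x))"
      unfolding q_def using D[of x] by (simp add: divide_simps) (simp add: power2_eq_square algebra_simps)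
    then show ?thesis
      unfolding h_def[abs_def] using DERIV_diff[OF Im_Ln_diagonal_deriv[of x] *] by simp
  qed
  have q: "q x \<ge> 0" if "x \<in> closed_segment 0 w" for x
    unfolding q_def using pos[OF that] D[of x] by (intro divide_nonneg_pos)
  have h0: "h 0 = 0"
  proof -
    have "Complex 1 0 = 1" by (simp add: complex_eq_iff)
    then show ?thesis by (simp add: h_def)
  qed
  have "h w \<le> h 0"
  proof (cases "w \<ge> 0")
    case True
    show ?thesis
    proof (rule DERIV_nonpos_imp_nonincreasing[OF True])
      fix x assume "0 \<le> x" "x \<le> w"
      then show "\<exists>y. DERIV h x :> y \<and> y \<le> 0"
        using q[of x] deriv[of x] by (auto simp: closed_segment_eq_real_ivl)
    qed
  next
    case False
    show ?thesis
    proof (rule DERIV_nonneg_imp_nondecreasing[of w 0 h])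
      fix x assume "w \<le> x" "x \<le> 0"
      then show "\<exists>y. DERIV h x :> y \<and> y \<ge> 0"
        using q[of x] deriv[of x]
        by (intro exI[of _ "- x * q x"]) (auto simp: closed_segment_eq_real_ivl mult_nonpos_nonneg)
    qed (use False in auto)
  qed
  then show ?thesis
    by (simp add: h0) (simp add: h_def)
qed

text \<open>For k = 3/2 the linear coefficient drops out and the quadratic is 1 - 2 x^2, nonnegative
  up to 1 / sqrt 2; 7/10 lies just below.\<close>

lemma Im_Ln_diagonal_le_near:
  fixes w :: real
  assumes "\<bar>w\<bar> \<le> 7 / 10"
  shows "Im (Ln (Complex (1 + w) w)) \<le> w - w\<^sup>2 / 2"
proof -
  have "Im (Ln (Complex (1 + w) w)) \<le> w + (1 - 3 / 2) * w\<^sup>2"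
  proof (rule Im_Ln_diagonal_le)
    fix x :: real assume "x \<in> closed_segment 0 w"
    then have "\<bar>x\<bar> \<le> 7 / 10"
      using assms by (auto simp: closed_segment_eq_real_ivl split: if_splits)
    then have "x\<^sup>2 \<le> (7 / 10)\<^sup>2"
      by (metis abs_ge_zero power2_abs power_mono)
    then show "0 \<le> (4 - 2 * (3 / 2)) + (6 - 4 * (3 / 2)) * x + 4 * (1 - 3 / 2) * x\<^sup>2"
      by (simp add: power2_eq_square)
  qed
  then show ?thesis by simp
qed

text \<open>For k = 3/4 the quadratic is a square plus 1/4. The wrong sign of the w^2 term is
  harmless, since the term - 2 pi b^2 w^2 of the exponent outweighs it.\<close>

lemma Im_Ln_diagonal_le_global:
  fixes w :: real
  shows "Im (Ln (Complex (1 + w) w)) \<le> w + w\<^sup>2 / 4"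
proof -
  have "Im (Ln (Complex (1 + w) w)) \<le> w + (1 - 3 / 4) * w\<^sup>2"
  proof (rule Im_Ln_diagonal_le)
    fix x :: real
    have "(4 - 2 * (3 / 4)) + (6 - 4 * (3 / 4)) * x + 4 * (1 - 3 / 4) * x\<^sup>2 =
          (x + 3 / 2)\<^sup>2 + 1 / 4"
      by (simp add: power2_eq_square algebra_simps)
    then show "0 \<le> (4 - 2 * (3 / 4)) + (6 - 4 * (3 / 4)) * x + 4 * (1 - 3 / 4) * x\<^sup>2"
      by simp
  qed
  then show ?thesis by simp
qed

section \<open>The modulus of the denominator and of the integrand\<close>

lemma norm_exp_i_minus_exp_neg_i_power2:
  "(norm (exp (\<i> * z) - exp (- (\<i> * z))))\<^sup>2 = exp (2 * Im z) + exp (- 2 * Im z) - 2 * cos (2 * Re z)"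
proof -
  have e: "exp x * exp x = exp (2 * x)" "exp x * exp (-x) = 1" for x :: real
    by (simp_all flip: exp_add)
  have "(norm (exp (\<i> * z) - exp (- (\<i> * z))))\<^sup>2 =
      (exp (- Im z) * cos (Re z) - exp (Im z) * cos (Re z))\<^sup>2 +
      (exp (- Im z) * sin (Re z) + exp (Im z) * sin (Re z))\<^sup>2"
    by (simp add: cmod_power2 Re_exp Im_exp)
  also have "\<dots> = (exp (- Im z) * exp (- Im z) + exp (Im z) * exp (Im z)) * ((cos (Re z))\<^sup>2 + (sin (Re z))\<^sup>2)
      - 2 * (exp (Im z) * exp (- Im z)) * ((cos (Re z))\<^sup>2 - (sin (Re z))\<^sup>2)"
    by algebra
  also have "\<dots> = exp (2 * Im z) + exp (- 2 * Im z) - 2 * cos (2 * Re z)"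
    using e(1)[of "Im z"] e(1)[of "- Im z"] e(2)[of "Im z"] by (simp only: cos_double sin_cos_squared_add2) simp
  finally show ?thesis .
qed

text \<open>This makes exp y + exp (- y) + 2 cos y at least 3/4 exp y. Up to 2 pi / 3 the cosine is
  at least - 1/2 and the arithmetic-geometric mean inequality suffices; beyond it exp y \<ge> 8, so
  exp y / 4 alone reaches 2.\<close>

lemma cos_ge_neg_exp:
  fixes y :: real
  assumes "y \<ge> 0"
  shows "- 2 * cos y \<le> exp y / 4 + exp (- y)"
proof (cases "y \<le> 2 * pi / 3")
  case True
  have "cos (2 * pi / 3) \<le> cos y"
    using assms True by (intro cos_monotone_0_pi_le) auto
  then have "cos y \<ge> - 1 / 2"
    by (simp add: cos_120)
  moreover have "1 \<le> exp y / 4 + exp (- y)"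
  proof -
    have "exp y / 4 + exp (- y) - 1 = exp (- y) * (exp y / 2 - 1)\<^sup>2"
      by (simp add: power2_eq_square algebra_simps exp_minus)
    also have "\<dots> \<ge> 0" by simp
    finally show ?thesis by simp
  qed
  ultimately show ?thesis by simp
next
  case False
  have e: "2.71 \<le> exp (1 :: real)"
    using e_approx_32 by (simp add: abs_if split: if_splits)
  \<comment> \<open>The split 2.094 = 2 + 94/1000 approximates 2 pi / 3 from below.\<close>
  have "(8 :: real) \<le> 2.71 ^ 2 * (1 + 94 / 1000)"
    by (simp add: power2_eq_square)
  also have "\<dots> \<le> exp 1 ^ 2 * exp (94 / 1000)"
    using exp_ge_add_one_self[of "94/1000 :: real"] e
    by (intro mult_mono power_mono) simp_all
  also have "\<dots> = exp (2.094)"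
    by (simp flip: exp_of_nat_mult exp_add)
  also have "\<dots> \<le> exp y"
    using False pi_approx by simp
  finally have "8 \<le> exp y" .
  then show ?thesis
    using cos_ge_minus_one[of y] exp_gt_zero[of "- y"] by linarith
qed

text \<open>The half-integer shifts the cosine by pi, so its sign is favourable near v = 0. On the
  diagonal the real and imaginary displacements agree, so one variable y = 2 pi |v| enters both the
  cosine and the exponentials.\<close>

lemma norm_sin_denominator_half_integer_ge:
  fixes v :: real and N :: nat
  defines "x \<equiv> Complex (real N + 1 / 2 + v) v"
  shows "sqrt 3 / 2 * exp (pi * \<bar>v\<bar>) \<le>
         norm (exp (of_real pi * \<i> * x) - exp (- (of_real pi * \<i> * x)))"
proof -
  define y where "y = 2 * pi * \<bar>v\<bar>"
  have "cos (2 * Re (of_real pi * x)) = cos (pi + 2 * pi * v + 2 * pi * real N)"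
    by (simp add: x_def algebra_simps)
  also have "\<dots> = cos (pi + 2 * pi * v)"
    using cos.plus_of_nat[of "pi + 2 * pi * v" N] by (simp add: mult_ac)
  also have "\<dots> = - cos y"
    by (simp add: y_def abs_if)
  finally have cos: "cos (2 * Re (of_real pi * x)) = - cos y" .
  have "exp (2 * Im (of_real pi * x)) + exp (- 2 * Im (of_real pi * x)) = exp y + exp (- y)"
    by (simp add: x_def y_def abs_if mult_ac)
  then have eq: "(norm (exp (\<i> * (of_real pi * x)) - exp (- (\<i> * (of_real pi * x)))))\<^sup>2 = exp y + exp (- y) + 2 * cos y"
    unfolding norm_exp_i_minus_exp_neg_i_power2 cos by simp
  have "(sqrt 3 / 2 * exp (pi * \<bar>v\<bar>))\<^sup>2 = 3 / 4 * exp y"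
    by (simp add: y_def power_mult_distrib power_divide flip: exp_of_nat_mult)
  also have "\<dots> \<le> exp y + exp (- y) + 2 * cos y"
    using cos_ge_neg_exp[of y] by (simp add: y_def)
  also note eq[symmetric]
  finally have "sqrt 3 / 2 * exp (pi * \<bar>v\<bar>) \<le> norm (exp (\<i> * (of_real pi * x)) - exp (- (\<i> * (of_real pi * x))))"
    by (rule power2_le_imp_le) simp
  then show ?thesis
    by (simp add: mult_ac)
qed

lemma norm_powr_minus_complex:
  assumes "z \<noteq> 0"
  shows "norm (z powr (- s)) = norm z powr (- Re s) * exp (Im s * Im (Ln z))"
proof -
  have "norm (z powr (- s)) = exp (- Re s * ln (norm z) + Im s * Im (Ln z))"
    using assms by (simp add: powr_def norm_exp_eq_Re del: exp_minus)
  then show ?thesis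
    using assms by (simp only: powr_def exp_add) simp
qed

lemma norm_aux_integrand:
  assumes "x \<noteq> 0"
  shows "norm (aux_integrand s x) =
    norm x powr (- Re s) * exp (Im s * Im (Ln x) - 2 * pi * Re x * Im x) /
    norm (exp (of_real pi * \<i> * x) - exp (- (of_real pi * \<i> * x)))"
proof -
  have "norm (exp (of_real pi * \<i> * x\<^sup>2)) = exp (- (2 * pi * Re x * Im x))"
    by (simp add: norm_exp_eq_Re power2_eq_square)
  then show ?thesis
    using assms
    by (simp add: aux_integrand_def norm_mult norm_divide norm_powr_minus_complex exp_diff exp_minus field_simps)
qed

text \<open>Write x = b (1 + w + i w): the positive factor b does not affect the argument. Since
  |x|^2 \<ge> b^2 / 2 \<ge> 1, the exponent - \<sigma> may be replaced by - 2, which makes the bound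
  independent of \<sigma>.\<close>

lemma norm_aux_integrand_half_integer_line_le:
  fixes N :: nat and \<sigma> \<xi> v b w :: real
  assumes "2 \<le> N" "2 \<le> \<sigma>" and b: "b = real N + 1 / 2" and w: "w = v / b"
  shows "norm (aux_integrand (Complex \<sigma> (2 * pi * \<xi>\<^sup>2)) (Complex (b + v) v)) \<le>
    2 / sqrt 3 / b\<^sup>2 * (exp (- (pi * \<bar>v\<bar>)) / (1 + 2 * w + 2 * w\<^sup>2)) *
      exp (2 * pi * \<xi>\<^sup>2 * Im (Ln (Complex (1 + w) w)) - 2 * pi * b\<^sup>2 * (w + w\<^sup>2))"
proof -
  define x where "x = Complex (b + v) v"
  have "b \<ge> 5 / 2"
    using assms by simp
  then have v: "v = b * w"
    using w by simp
  have x: "x = of_real b * Complex (1 + w) w"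
    by (simp add: x_def v complex_eq_iff algebra_simps)
  have norm2: "(norm x)\<^sup>2 = b\<^sup>2 * (1 + 2 * w + 2 * w\<^sup>2)"
    unfolding x cmod_power2 by (simp add: power2_eq_square algebra_simps)
  have D: "1 + 2 * w + 2 * w\<^sup>2 \<ge> 1 / 2"
  proof -
    have "1 + 2 * w + 2 * w\<^sup>2 = 2 * (w + 1 / 2)\<^sup>2 + 1 / 2"
      by (simp add: power2_eq_square algebra_simps)
    then show ?thesis by simp
  qed
  have b2: "b\<^sup>2 \<ge> 6"
    using power_mono[of "5/2" b 2] \<open>b \<ge> 5 / 2\<close> by (simp add: power2_eq_square)
  have "1 \<le> (norm x)\<^sup>2"
    unfolding norm2 using mult_mono[OF b2 D] by simp
  then have x1: "norm x \<ge> 1"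
    by (metis norm_ge_zero one_power2 power2_le_imp_le)
  then have x0: "x \<noteq> 0" by auto
  have "norm x powr (- \<sigma>) \<le> norm x powr (- 2)"
    using assms x1 by (intro powr_mono) auto
  also have "\<dots> = 1 / (b\<^sup>2 * (1 + 2 * w + 2 * w\<^sup>2))"
    using x1 by (simp add: powr_minus divide_inverse powr_numeral flip: norm2)
  finally have pw: "norm x powr (- \<sigma>) \<le> 1 / (b\<^sup>2 * (1 + 2 * w + 2 * w\<^sup>2))" .
  have Ln: "Im (Ln x) = Im (Ln (Complex (1 + w) w))"
  proof -
    have "Complex (1 + w) w \<noteq> 0"
      using x0 x by auto
    then show ?thesis
      unfolding x using \<open>b \<ge> 5 / 2\<close> by (subst Ln_times_of_real) auto
  qed
  have e: "2 * pi * Re x * Im x = 2 * pi * b\<^sup>2 * (w + w\<^sup>2)"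
    by (simp add: x power2_eq_square algebra_simps)
  let ?E = "exp (2 * pi * \<xi>\<^sup>2 * Im (Ln (Complex (1 + w) w)) - 2 * pi * b\<^sup>2 * (w + w\<^sup>2))"
  have "norm (aux_integrand (Complex \<sigma> (2 * pi * \<xi>\<^sup>2)) x) =
    norm x powr (- \<sigma>) * ?E /
    norm (exp (of_real pi * \<i> * x) - exp (- (of_real pi * \<i> * x)))"
    by (simp add: norm_aux_integrand[OF x0] Ln e)
  also have "\<dots> \<le> 1 / (b\<^sup>2 * (1 + 2 * w + 2 * w\<^sup>2)) * ?E / (sqrt 3 / 2 * exp (pi * \<bar>v\<bar>))"
    using norm_sin_denominator_half_integer_ge[of v N] pw D
    by (intro frac_le mult_right_mono mult_nonneg_nonneg) (auto simp: x_def b)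
  also have "\<dots> = 2 / sqrt 3 / b\<^sup>2 * (exp (- (pi * \<bar>v\<bar>)) / (1 + 2 * w + 2 * w\<^sup>2)) * ?E"
    by (simp add: exp_minus field_simps)
  finally show ?thesis
    by (simp add: x_def)
qed

section \<open>Gaussian majorants and their integrals\<close>

lemma aux_line_eq: "aux_line c u = Complex (c + u / sqrt 2) (u / sqrt 2)"
proof -
  have "exp (\<i> * complex_of_real (pi / 4)) = Complex (1 / sqrt 2) (1 / sqrt 2)"
    by (simp add: complex_eq_iff Re_exp Im_exp cos_45 sin_45 real_div_sqrt field_simps)
  then show ?thesis
    by (simp add: aux_line_def complex_eq_iff)
qed

text \<open>Completing the square gives a multiple of the normal density with mean b / (2 a) and
  variance 1 / (2 a).\<close>

lemma has_bochner_integral_gaussian: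
  fixes a b :: real
  assumes "a > 0"
  shows "has_bochner_integral lborel (\<lambda>u. exp (b * u - a * u\<^sup>2)) (sqrt (pi / a) * exp (b\<^sup>2 / (4 * a)))"
proof -
  define \<sigma> \<mu> where "\<sigma> = sqrt (1 / (2 * a))" and "\<mu> = b / (2 * a)"
  have \<sigma>: "\<sigma>\<^sup>2 = 1 / (2 * a)"
    using assms by (simp add: \<sigma>_def)
  have "has_bochner_integral lborel (\<lambda>u. sqrt (pi / a) * exp (b\<^sup>2 / (4 * a)) * normal_density \<mu> \<sigma> u)
          (sqrt (pi / a) * exp (b\<^sup>2 / (4 * a)) * 1)"
    using assms by (intro has_bochner_integral_mult_right)
      (simp add: has_bochner_integral_iff \<sigma>_def)
  moreover have "sqrt (pi / a) * exp (b\<^sup>2 / (4 * a)) * normal_density \<mu> \<sigma> u = exp (b * u - a * u\<^sup>2)" for u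
  proof -
    have "b\<^sup>2 / (4 * a) + (- (u - \<mu>)\<^sup>2 / (2 * \<sigma>\<^sup>2)) = b * u - a * u\<^sup>2"
      using assms unfolding \<sigma> \<mu>_def by (simp add: power2_eq_square field_simps)
    then have "exp (b\<^sup>2 / (4 * a)) * exp (- (u - \<mu>)\<^sup>2 / (2 * \<sigma>\<^sup>2)) = exp (b * u - a * u\<^sup>2)"
      by (simp only: flip: exp_add)
    moreover have "sqrt (pi / a) * (1 / sqrt (2 * pi * \<sigma>\<^sup>2)) = 1"
      using assms by (simp add: \<sigma>)
    ultimately show ?thesis
      using assms by (simp add: normal_density_def)
  qed
  ultimately show ?thesis
    by simp
qed

text \<open>The term $e^{\pi l' v}$ stands for the decay of the denominator and of $|x|^{-2}$, in the direction in which
  it compensates the linear term $2 \pi (\xi^2 - b^2) w$ of the exponent. The second summand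
  absorbs the range $|w| > 7/10$, where only a weaker bound on the argument is available.\<close>

lemma aux_integrand_half_integer_line_gaussian:
  fixes N :: nat and \<sigma> \<xi> v b l q l' M :: real
  assumes "2 \<le> N" "2 \<le> \<sigma>" and b: "b = real N + 1 / 2"
    and \<xi>: "\<xi>\<^sup>2 \<le> 36 / 25 * b\<^sup>2" and q: "q * b\<^sup>2 \<le> 2 * b\<^sup>2 + \<xi>\<^sup>2" and l: "\<bar>l\<bar> \<le> 6 / 5"
    and l': "l' * b = l * b - 2 * (\<xi>\<^sup>2 - b\<^sup>2)" and "0 \<le> M"
    and M: "exp (- (pi * \<bar>v\<bar>)) / (1 + 2 * (v / b) + 2 * (v / b)\<^sup>2) \<le> M * exp (pi * l' * v)"
  shows "norm (aux_integrand (Complex \<sigma> (2 * pi * \<xi>\<^sup>2)) (Complex (b + v) v)) \<le>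
    2 / sqrt 3 / b\<^sup>2 * M * (exp (pi * l * v - pi * q * v\<^sup>2) + exp (- (9 / 10 * pi) - 3 / 10 * pi * v\<^sup>2))"
proof -
  define w where "w = v / b"
  define A where "A = Im (Ln (Complex (1 + w) w))"
  define X where "X = 2 * pi * \<xi>\<^sup>2 * A - 2 * pi * b\<^sup>2 * (w + w\<^sup>2)"
  have b52: "b \<ge> 5 / 2"
    using assms by simp
  then have v: "v = b * w"
    by (simp add: w_def)
  \<comment> \<open>An argument bound with quadratic coefficient k turns into a Gaussian of rate r.
    The relation between \<open>l'\<close> and \<open>l\<close> says precisely that the linear terms
    combine to pi l v.\<close>
  have X_le: "pi * l' * v + X \<le> pi * l * v - pi * r * v\<^sup>2"
    if "A \<le> w + k * w\<^sup>2" "r * b\<^sup>2 \<le> 2 * b\<^sup>2 - 2 * k * \<xi>\<^sup>2" for k r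
  proof -
    have "2 * pi * \<xi>\<^sup>2 * A \<le> 2 * pi * \<xi>\<^sup>2 * (w + k * w\<^sup>2)"
      using that by (intro mult_left_mono) auto
    then have "pi * l' * v + X \<le> pi * (l' * b) * w + 2 * pi * (\<xi>\<^sup>2 - b\<^sup>2) * w - pi * (2 * b\<^sup>2 - 2 * k * \<xi>\<^sup>2) * w\<^sup>2"
      by (simp add: X_def v algebra_simps)
    also have "\<dots> = pi * l * v - pi * (2 * b\<^sup>2 - 2 * k * \<xi>\<^sup>2) * w\<^sup>2"
      unfolding l' by (simp add: v algebra_simps)
    also have "\<dots> \<le> pi * l * v - pi * (r * b\<^sup>2) * w\<^sup>2"
      using that by (intro diff_left_mono mult_right_mono mult_left_mono) auto
    finally show ?thesis
      by (simp add: v power_mult_distrib mult_ac)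
  qed
  have "exp (pi * l' * v + X) \<le> exp (pi * l * v - pi * q * v\<^sup>2) + exp (- (9 / 10 * pi) - 3 / 10 * pi * v\<^sup>2)"
  proof (cases "\<bar>w\<bar> \<le> 7 / 10")
    case True
    have "pi * l' * v + X \<le> pi * l * v - pi * q * v\<^sup>2"
      using Im_Ln_diagonal_le_near[OF True] q by (intro X_le[of "- 1 / 2"]) (auto simp: A_def)
    then show ?thesis
      by (metis add_increasing2 exp_ge_zero exp_le_cancel_iff)
  next
    case False
    then have "\<bar>v\<bar> \<ge> 5 / 2 * (7 / 10)"
      unfolding v abs_mult using b52 by (intro mult_mono) auto
    then have v74: "\<bar>v\<bar> - 7 / 4 \<ge> 0" by simp
    \<comment> \<open>The rate is 32/25 = 2 - (1/2) (36/25), from k = 1/4 and the bound on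
      \<xi>^2.\<close>
    have "pi * l' * v + X \<le> pi * l * v - pi * (32 / 25) * v\<^sup>2"
      using Im_Ln_diagonal_le_global[of w] \<xi> by (intro X_le[of "1 / 4"]) (auto simp: A_def)
    also have "\<dots> = pi * (l * v - 32 / 25 * v\<^sup>2)"
      by (simp add: algebra_simps)
    also have "\<dots> \<le> pi * (- 9 / 10 - 3 / 10 * v\<^sup>2)"
    proof (intro mult_left_mono)
      have "l * v \<le> 6 / 5 * \<bar>v\<bar>"
        using mult_right_mono[OF l, of "\<bar>v\<bar>"] abs_ge_self[of "l * v"] by (simp add: abs_mult)
      \<comment> \<open>Here 98/100 = 32/25 - 3/10. The constants 9/10 and 3/10 are chosen so that
        98/100 a^2 - 6/5 a - 9/10 is just nonnegative at a = 7/4, the least |v| of this case; the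
        product is this quadratic up to a tiny constant.\<close>
      moreover have "0 \<le> (\<bar>v\<bar> - 7 / 4) * (98 / 100 * \<bar>v\<bar> + 515 / 1000)"
        using v74 by (intro mult_nonneg_nonneg) auto
      moreover have "(a - 7 / 4) * (98 / 100 * a + 515 / 1000) \<le> 98 / 100 * a\<^sup>2 - 6 / 5 * a - 9 / 10"
        for a :: real
        by (simp add: power2_eq_square field_simps)
      from this[of "\<bar>v\<bar>"] have "(\<bar>v\<bar> - 7 / 4) * (98 / 100 * \<bar>v\<bar> + 515 / 1000) \<le> 98 / 100 * v\<^sup>2 - 6 / 5 * \<bar>v\<bar> - 9 / 10"
        by (simp only: power2_abs)
      ultimately show "l * v - 32 / 25 * v\<^sup>2 \<le> - 9 / 10 - 3 / 10 * v\<^sup>2"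
        by simp
    qed simp
    finally have "pi * l' * v + X \<le> - (9 / 10 * pi) - 3 / 10 * pi * v\<^sup>2"
      by (simp add: algebra_simps)
    then show ?thesis
      by (metis add_increasing exp_ge_zero exp_le_cancel_iff)
  qed
  note E = this
  have "norm (aux_integrand (Complex \<sigma> (2 * pi * \<xi>\<^sup>2)) (Complex (b + v) v)) \<le>
    2 / sqrt 3 / b\<^sup>2 * (exp (- (pi * \<bar>v\<bar>)) / (1 + 2 * w + 2 * w\<^sup>2)) * exp X"
    unfolding X_def A_def
    by (rule norm_aux_integrand_half_integer_line_le[OF assms(1-3) w_def])
  also have "\<dots> \<le> 2 / sqrt 3 / b\<^sup>2 * (M * exp (pi * l' * v)) * exp X"
    using M by (intro mult_right_mono mult_left_mono) (auto simp: w_def)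
  also have "\<dots> = 2 / sqrt 3 / b\<^sup>2 * M * exp (pi * l' * v + X)"
    by (simp add: exp_add)
  also have "\<dots> \<le> 2 / sqrt 3 / b\<^sup>2 * M *
      (exp (pi * l * v - pi * q * v\<^sup>2) + exp (- (9 / 10 * pi) - 3 / 10 * pi * v\<^sup>2))"
    using E \<open>0 \<le> M\<close> by (intro mult_left_mono) auto
  finally show ?thesis .
qed

text \<open>The substitution v = u / sqrt 2 halves the Gaussian rates, whence sqrt (2 / q) and sqrt
  (20 / 3). The reversed orientation only changes the sign.\<close>

lemma norm_riemann_aux_le:
  assumes "q > 0"
    and le: "\<And>v. norm (aux_integrand s (Complex (b + v) v)) \<le>
      K * (exp (pi * l * v - pi * q * v\<^sup>2) + exp (- (9 / 10 * pi) - 3 / 10 * pi * v\<^sup>2))"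
  shows "norm (riemann_aux b s) \<le>
    K * (sqrt (2 / q) * exp (pi * l\<^sup>2 / (4 * q)) + exp (- (9 / 10 * pi)) * sqrt (20 / 3))"
proof -
  let ?f = "\<lambda>u. aux_integrand s (aux_line b u) * exp (\<i> * of_real (pi / 4))"
  let ?g = "\<lambda>u. K * (exp (pi * l / sqrt 2 * u - pi * q / 2 * u\<^sup>2) +
     exp (- (9 / 10 * pi)) * exp (0 * u - 3 / 20 * pi * u\<^sup>2))"
  have 1: "has_bochner_integral lborel (\<lambda>u. exp (pi * l / sqrt 2 * u - pi * q / 2 * u\<^sup>2))
      (sqrt (2 / q) * exp (pi * l\<^sup>2 / (4 * q)))"
    using has_bochner_integral_gaussian[of "pi * q / 2" "pi * l / sqrt 2"] \<open>q > 0\<close>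
    by (simp add: power_divide power_mult_distrib power2_eq_square mult_ac)
  have 2: "has_bochner_integral lborel (\<lambda>u. exp (0 * u - 3 / 20 * pi * u\<^sup>2)) (sqrt (20 / 3))"
    using has_bochner_integral_gaussian[of "3 / 20 * pi" 0] by simp
  have g: "has_bochner_integral lborel ?g
     (K * (sqrt (2 / q) * exp (pi * l\<^sup>2 / (4 * q)) + exp (- (9 / 10 * pi)) * sqrt (20 / 3)))"
    by (intro has_bochner_integral_mult_right has_bochner_integral_add 1 2)
  have fg: "norm (?f u) \<le> ?g u" for u
  proof -
    have "norm (?f u) = norm (aux_integrand s (Complex (b + u / sqrt 2) (u / sqrt 2)))"
      by (simp add: norm_mult aux_line_eq)
    also note le
    also have "pi * l * (u / sqrt 2) - pi * q * (u / sqrt 2)\<^sup>2 = pi * l / sqrt 2 * u - pi * q / 2 * u\<^sup>2"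
      by (simp add: power_divide)
    also have "exp (- (9 / 10 * pi) - 3 / 10 * pi * (u / sqrt 2)\<^sup>2) =
        exp (- (9 / 10 * pi)) * exp (0 * u - 3 / 20 * pi * u\<^sup>2)"
      by (simp add: power_divide flip: exp_add)
    finally show ?thesis .
  qed
  have "riemann_aux b s = - (LINT u|lborel. ?f u)"
    by (simp add: riemann_aux_def interval_lebesgue_integral_def einterval_def set_lebesgue_integral_def)
  then have "norm (riemann_aux b s) \<le> (LINT u|lborel. norm (?f u))"
    using integral_norm_bound[of lborel ?f] by simp
  also have "\<dots> \<le> (LINT u|lborel. ?g u)"
  proof (rule integral_mono')
    show "integrable lborel ?g"
      using g by (simp only: has_bochner_integral_iff)
    show "0 \<le> ?g u" for u
      by (rule order_trans[OF norm_ge_zero fg])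
  qed (rule fg)
  also have "\<dots> = K * (sqrt (2 / q) * exp (pi * l\<^sup>2 / (4 * q)) + exp (- (9 / 10 * pi)) * sqrt (20 / 3))"
    using g by (rule has_bochner_integral_integral_eq)
  finally show ?thesis .
qed

section \<open>Explicit bounds on either side of the saddle point\<close>

lemma exp_neg_9_10_pi_le: "exp (- (9 / 10 * pi)) * sqrt (20 / 3) \<le> 0.2266"
proof -
  \<comment> \<open>2.8 lies below 9 pi / 10; squaring the Taylor bound at 1.4 is much sharper than
    applying it at 2.8.\<close>
  have "11.4 \<le> (1 + 1.4 + (1.4 :: real)\<^sup>2 / 2)\<^sup>2"
    by (simp add: power2_eq_square)
  also have "\<dots> \<le> exp 1.4 ^ 2"
    using exp_lower_Taylor_quadratic[of "1.4 :: real"] by (intro power_mono) auto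
  also have "\<dots> = exp (2.8 :: real)"
    by (simp flip: exp_of_nat_mult)
  also have "\<dots> \<le> exp (9 / 10 * pi)"
    using pi_approx by simp
  finally have "exp (- (9 / 10 * pi)) \<le> 1 / 11.4"
    by (simp add: exp_minus divide_simps)
  moreover have "sqrt (20 / 3) \<le> 2.583"
    by (intro real_le_lsqrt) (auto simp: power2_eq_square)
  ultimately have "exp (- (9 / 10 * pi)) * sqrt (20 / 3) \<le> 1 / 11.4 * 2.583"
    by (intro mult_mono) auto
  also have "1 / 11.4 * 2.583 \<le> (0.2266 :: real)" by simp
  finally show ?thesis .
qed

lemma exp_quadratic_upper_le:
  fixes x y :: real
  assumes "0 \<le> x" "x \<le> y" "y \<le> 1"
  shows "exp x \<le> 1 + y + y\<^sup>2"
  using exp_bound[of x] assms power_mono[of x y 2] by linarith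

text \<open>For b \<le> \<xi> the linear term grows with v, so the denominator is used as exp (- pi
  v), that is l' = - 1. As \<xi>^2 - b^2 lies between 0 and 11/10 b, the remaining slope is between
  - 1 and 6/5. The rate q = 3 comes from b^2 \<le> \<xi>^2.\<close>

lemma norm_riemann_aux_half_integer_le_right:
  fixes N :: nat and \<sigma> \<xi> b :: real
  assumes "2 \<le> N" "2 \<le> \<sigma>" and b: "b = real N + 1 / 2" and \<xi>: "b \<le> \<xi>" "\<xi> \<le> b + 1 / 2"
  shows "norm (riemann_aux b (Complex \<sigma> (2 * pi * \<xi>\<^sup>2))) \<le> 1 / \<xi>"
proof -
  define l where "l = 2 * (\<xi>\<^sup>2 - b\<^sup>2) / b - 1"
  have b52: "b \<ge> 5 / 2"
    using assms by simp
  have sq: "(b + 1 / 2)\<^sup>2 \<le> (6 / 5 * b)\<^sup>2" "\<xi>\<^sup>2 \<le> (b + 1 / 2)\<^sup>2" "b\<^sup>2 \<le> \<xi>\<^sup>2"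
    using b52 \<xi> by (intro power_mono; simp)+
  have "0 \<le> \<xi>\<^sup>2 - b\<^sup>2" "\<xi>\<^sup>2 - b\<^sup>2 \<le> 11 / 10 * b"
    using sq b52 by (simp_all add: power2_eq_square algebra_simps)
  then have l: "\<bar>l\<bar> \<le> 6 / 5"
    unfolding l_def abs_le_iff using b52 by (simp add: field_simps)
  \<comment> \<open>M = 1 is possible: for v < 0, where the quadratic may fall to 1/2, exp (- pi v)
    exceeds exp (- pi |v|) by the factor exp (2 pi |v|), which compensates.\<close>
  have D: "exp (- (pi * \<bar>v\<bar>)) / (1 + 2 * (v / b) + 2 * (v / b)\<^sup>2) \<le> 1 * exp (pi * - 1 * v)" for v
  proof -
    define w where "w = v / b"
    have "1 \<le> exp (pi * (\<bar>v\<bar> - v)) * (1 + 2 * w + 2 * w\<^sup>2)"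
    proof (cases "v \<ge> 0")
      case True
      then show ?thesis
        using b52 by (simp add: w_def)
    next
      case False
      \<comment> \<open>In k the quadratic is 1 - k + k^2 / 2, the truncated series of exp (- k).
        Its product with the truncated series of exp k is 1 + k^4 / 4.\<close>
      define k where "k = - 2 * w"
      have k: "k \<ge> 0"
        using False b52 by (simp add: k_def w_def divide_simps)
      have "k \<le> - v"
        using False b52 by (simp add: k_def w_def field_simps)
      also have "\<dots> \<le> pi * (\<bar>v\<bar> - v)"
        using False pi_ge_two mult_right_mono[of 2 pi "- v"] by simp
      finally have "exp k \<le> exp (pi * (\<bar>v\<bar> - v))"
        by simp
      then have "1 + k + k\<^sup>2 / 2 \<le> exp (pi * (\<bar>v\<bar> - v))"
        using exp_lower_Taylor_quadratic[OF k] by linarith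
      moreover have "1 + 2 * w + 2 * w\<^sup>2 = 1 - k + k\<^sup>2 / 2"
        by (simp add: k_def power2_eq_square)
      moreover have "1 - k + k\<^sup>2 / 2 = (1 - k)\<^sup>2 / 2 + 1 / 2"
        by (simp add: power2_eq_square field_simps)
      ultimately have "(1 + k + k\<^sup>2 / 2) * (1 - k + k\<^sup>2 / 2) \<le> exp (pi * (\<bar>v\<bar> - v)) * (1 + 2 * w + 2 * w\<^sup>2)"
        by (metis mult_right_mono add_nonneg_nonneg divide_nonneg_nonneg zero_le_power2 zero_le_one zero_le_numeral)
      moreover have "(1 + k + k\<^sup>2 / 2) * (1 - k + k\<^sup>2 / 2) = 1 + (k\<^sup>2 / 2)\<^sup>2"
        by (simp add: power2_eq_square algebra_simps)
      ultimately show ?thesis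
        by (smt (verit) zero_le_power2)
    qed
    moreover have "1 + 2 * w + 2 * w\<^sup>2 > 0"
    proof -
      have "1 + 2 * w + 2 * w\<^sup>2 = 2 * (w + 1 / 2)\<^sup>2 + 1 / 2"
        by (simp add: power2_eq_square algebra_simps)
      then show ?thesis
        by (metis add_nonneg_pos mult_nonneg_nonneg zero_le_power2 zero_le_numeral half_gt_zero zero_less_one)
    qed
    ultimately have "1 / (1 + 2 * w + 2 * w\<^sup>2) \<le> exp (pi * (\<bar>v\<bar> - v))"
      by (simp only: pos_divide_le_eq)
    then have "exp (- (pi * \<bar>v\<bar>)) * (1 / (1 + 2 * w + 2 * w\<^sup>2)) \<le>
        exp (- (pi * \<bar>v\<bar>)) * exp (pi * (\<bar>v\<bar> - v))"
      by (intro mult_left_mono) auto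
    also have "\<dots> = exp (pi * - 1 * v)"
      by (simp add: algebra_simps flip: exp_add)
    finally show ?thesis
      by (simp add: w_def)
  qed
  have "norm (riemann_aux b (Complex \<sigma> (2 * pi * \<xi>\<^sup>2))) \<le>
    2 / sqrt 3 / b\<^sup>2 * 1 * (sqrt (2 / 3) * exp (pi * l\<^sup>2 / (4 * 3)) + exp (- (9 / 10 * pi)) * sqrt (20 / 3))"
  proof (rule norm_riemann_aux_le)
    fix v
    show "norm (aux_integrand (Complex \<sigma> (2 * pi * \<xi>\<^sup>2)) (Complex (b + v) v)) \<le>
      2 / sqrt 3 / b\<^sup>2 * 1 * (exp (pi * l * v - pi * 3 * v\<^sup>2) + exp (- (9 / 10 * pi) - 3 / 10 * pi * v\<^sup>2))"
    proof (rule aux_integrand_half_integer_line_gaussian[OF assms(1-3) _ _ l _ _ D])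
      show "\<xi>\<^sup>2 \<le> 36 / 25 * b\<^sup>2" "3 * b\<^sup>2 \<le> 2 * b\<^sup>2 + \<xi>\<^sup>2"
        using sq by (simp_all add: power_mult_distrib power_divide)
      show "- 1 * b = l * b - 2 * (\<xi>\<^sup>2 - b\<^sup>2)"
        using b52 by (simp add: l_def field_simps)
    qed auto
  qed auto
  also have "\<dots> \<le> 2 / sqrt 3 / b\<^sup>2 * 1 * (0.8165 * 1.52 + 0.2266)"
  proof (intro mult_left_mono add_mono mult_mono exp_neg_9_10_pi_le)
    show "sqrt (2 / 3) \<le> 0.8165"
      by (intro real_le_lsqrt) (auto simp: power2_eq_square)
    have "l\<^sup>2 \<le> (6 / 5)\<^sup>2"
      using l by (metis abs_ge_zero power2_abs power_mono)
    then have "pi * l\<^sup>2 \<le> 3.1416 * 1.44"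
      using pi_approx by (intro mult_mono) (auto simp: power2_eq_square)
    then have "exp (pi * l\<^sup>2 / (4 * 3)) \<le> 1 + 0.377 + 0.377\<^sup>2"
      by (intro exp_quadratic_upper_le) auto
    also have "\<dots> \<le> 1.52"
      by (simp add: power2_eq_square)
    finally show "exp (pi * l\<^sup>2 / (4 * 3)) \<le> 1.52" .
  qed auto
  also have "\<dots> = 2 / sqrt 3 * (0.8165 * 1.52 + 0.2266) / b\<^sup>2"
    by simp
  also have "\<dots> \<le> 1.1548 * 1.468 / b\<^sup>2"
  proof (intro divide_right_mono mult_mono)
    have "2 / 1.1548 \<le> sqrt 3"
      by (intro real_le_rsqrt) (auto simp: power2_eq_square)
    then show "2 / sqrt 3 \<le> 1.1548"
      by (simp add: divide_simps mult_ac)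
  qed auto
  also have "\<dots> \<le> 1 / \<xi>"
  proof -
    have "1.1548 * 1.468 * \<xi> \<le> 1.7 * (b + 1 / 2)"
      using \<xi> b52 by (intro mult_mono) auto
    also have "\<dots> \<le> b * b"
    proof -
      have "5 / 2 * b \<le> b * b"
        using b52 by (intro mult_right_mono) auto
      moreover have "1.7 * (b + 1 / 2) \<le> 5 / 2 * b"
        using b52 by simp
      ultimately show ?thesis
        by (rule order_trans[rotated])
    qed
    finally show ?thesis
      using \<xi> b52 by (simp add: divide_simps power2_eq_square)
  qed
  finally show ?thesis .
qed

text \<open>Now the linear term grows towards negative v and l' = 1 is the helpful sign; \<xi>^2 -
  b^2 between - b and 0 leaves a slope between - 1 and 1. From b \<ge> 7/2 follows \<xi> \<ge> 6/7
  b, hence q = 2.7 as 36/49 > 0.7.\<close>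

lemma norm_riemann_aux_half_integer_le_left:
  fixes N :: nat and \<sigma> \<xi> b :: real
  assumes "3 \<le> N" "2 \<le> \<sigma>" and b: "b = real N + 1 / 2" and \<xi>: "b - 1 / 2 \<le> \<xi>" "\<xi> \<le> b"
  shows "norm (riemann_aux b (Complex \<sigma> (2 * pi * \<xi>\<^sup>2))) \<le> 1 / \<xi>"
proof -
  define l where "l = 2 * (\<xi>\<^sup>2 - b\<^sup>2) / b + 1"
  have "2 \<le> N"
    using assms by simp
  have b72: "b \<ge> 7 / 2"
    using assms by simp
  have sq: "(6 / 7 * b)\<^sup>2 \<le> (b - 1 / 2)\<^sup>2" "(b - 1 / 2)\<^sup>2 \<le> \<xi>\<^sup>2" "\<xi>\<^sup>2 \<le> b\<^sup>2"
    using b72 \<xi> by (intro power_mono; simp)+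
  have "- b \<le> \<xi>\<^sup>2 - b\<^sup>2" "\<xi>\<^sup>2 - b\<^sup>2 \<le> 0"
    using sq b72 by (simp_all add: power2_eq_square algebra_simps)
  then have l: "\<bar>l\<bar> \<le> 1"
    unfolding l_def abs_le_iff using b72 by (simp add: field_simps)
  \<comment> \<open>For v < 0 both exponentials coincide, so nothing offsets the minimum 1/2 of the
    quadratic; hence M = 2.\<close>
  have D: "exp (- (pi * \<bar>v\<bar>)) / (1 + 2 * (v / b) + 2 * (v / b)\<^sup>2) \<le> 2 * exp (pi * 1 * v)" for v
  proof -
    define w where "w = v / b"
    have "1 + 2 * w + 2 * w\<^sup>2 = 2 * (w + 1 / 2)\<^sup>2 + 1 / 2"
      by (simp add: power2_eq_square algebra_simps)
    then have "1 + 2 * w + 2 * w\<^sup>2 \<ge> 1 / 2"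
      by simp
    then have "exp (- (pi * \<bar>v\<bar>)) / (1 + 2 * w + 2 * w\<^sup>2) \<le> exp (pi * v) / (1 / 2)"
      using mult_left_mono[of "- \<bar>v\<bar>" v pi] by (intro frac_le) auto
    then show ?thesis
      by (simp add: w_def)
  qed
  have "norm (riemann_aux b (Complex \<sigma> (2 * pi * \<xi>\<^sup>2))) \<le>
    2 / sqrt 3 / b\<^sup>2 * 2 * (sqrt (2 / 2.7) * exp (pi * l\<^sup>2 / (4 * 2.7)) + exp (- (9 / 10 * pi)) * sqrt (20 / 3))"
  proof (rule norm_riemann_aux_le)
    fix v
    show "norm (aux_integrand (Complex \<sigma> (2 * pi * \<xi>\<^sup>2)) (Complex (b + v) v)) \<le>
      2 / sqrt 3 / b\<^sup>2 * 2 * (exp (pi * l * v - pi * 2.7 * v\<^sup>2) + exp (- (9 / 10 * pi) - 3 / 10 * pi * v\<^sup>2))"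
    proof (rule aux_integrand_half_integer_line_gaussian[OF \<open>2 \<le> N\<close> assms(2,3) _ _ _ _ _ D])
      have "(b - 1 / 2)\<^sup>2 \<ge> 0.7 * b\<^sup>2"
      proof -
        have "(6 / 7 * b)\<^sup>2 = 36 / 49 * b\<^sup>2"
          by (simp add: power_mult_distrib power_divide)
        then show ?thesis
          using sq(1) zero_le_power2[of b] by linarith
      qed
      then show "2.7 * b\<^sup>2 \<le> 2 * b\<^sup>2 + \<xi>\<^sup>2"
        using sq(2) by (simp add: algebra_simps)
      show "\<xi>\<^sup>2 \<le> 36 / 25 * b\<^sup>2"
        using sq(3) zero_le_power2[of b] by linarith
      show "1 * b = l * b - 2 * (\<xi>\<^sup>2 - b\<^sup>2)"
        using b72 by (simp add: l_def field_simps)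
    qed (use l in auto)
  qed auto
  also have "\<dots> \<le> 2 / sqrt 3 / b\<^sup>2 * 2 * (0.861 * 1.376 + 0.2266)"
  proof (intro mult_left_mono add_mono mult_mono exp_neg_9_10_pi_le)
    show "sqrt (2 / 2.7) \<le> 0.861"
      by (intro real_le_lsqrt) (auto simp: power2_eq_square)
    have "l\<^sup>2 \<le> 1\<^sup>2"
      using l by (metis abs_ge_zero power2_abs power_mono)
    then have "pi * l\<^sup>2 \<le> 3.1416 * 1"
      using pi_approx by (intro mult_mono) auto
    then have "exp (pi * l\<^sup>2 / (4 * 2.7)) \<le> 1 + 0.291 + 0.291\<^sup>2"
      by (intro exp_quadratic_upper_le) auto
    also have "\<dots> \<le> 1.376"
      by (simp add: power2_eq_square)
    finally show "exp (pi * l\<^sup>2 / (4 * 2.7)) \<le> 1.376" .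
  qed auto
  also have "\<dots> = 2 / sqrt 3 * (2 * (0.861 * 1.376 + 0.2266)) / b\<^sup>2"
    by simp
  also have "\<dots> \<le> 1.1548 * 2.824 / b\<^sup>2"
  proof (intro divide_right_mono mult_mono)
    have "2 / 1.1548 \<le> sqrt 3"
      by (intro real_le_rsqrt) (auto simp: power2_eq_square)
    then show "2 / sqrt 3 \<le> 1.1548"
      by (simp add: divide_simps mult_ac)
  qed auto
  also have "\<dots> \<le> 1 / \<xi>"
  proof -
    have "1.1548 * 2.824 * \<xi> \<le> 3.3 * b"
      using \<xi> b72 by (intro mult_mono) auto
    also have "\<dots> \<le> b * b"
    proof -
      have "7 / 2 * b \<le> b * b"
        using b72 by (intro mult_right_mono) auto
      moreover have "3.3 * b \<le> 7 / 2 * b"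
        using b72 by simp
      ultimately show ?thesis
        by (rule order_trans[rotated])
    qed
    finally show ?thesis
      using \<xi> b72 by (simp add: divide_simps power2_eq_square)
  qed
  finally show ?thesis .
qed

section \<open>Moving the line of integration\<close>

definition rot :: complex where
  "rot = Complex (1 / sqrt 2) (1 / sqrt 2)"

lemma rot_eq_exp: "rot = exp (\<i> * of_real (pi / 4))"
  by (simp add: rot_def complex_eq_iff Re_exp Im_exp cos_45 sin_45 real_div_sqrt field_simps)

lemma rot_mult: "rot * y = Complex ((Re y - Im y) / sqrt 2) ((Re y + Im y) / sqrt 2)"
  by (simp add: rot_def complex_eq_iff diff_divide_distrib add_divide_distrib)

text \<open>The real axis becomes the antidiagonal: the positive integers fall into the lower
  half-plane, the branch cut into the closed upper one. This locates the poles and keeps them apart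
  from the cut.\<close>

lemma rot_mult_eq_of_real_iff:
  "rot * y = of_real r \<longleftrightarrow> y = Complex (r / sqrt 2) (- r / sqrt 2)"
proof -
  have "y = Complex (r / sqrt 2) (- r / sqrt 2)" if "Re y + Im y = 0" "Re y - Im y = r * sqrt 2"
  proof -
    have "Re y = r * (sqrt 2 / 2)"
      using that by simp
    moreover have "sqrt 2 / 2 = 1 / sqrt 2"
      by (simp add: divide_simps)
    ultimately show ?thesis
      using that by (simp add: complex_eq_iff)
  qed
  moreover have "rot * y = of_real r" if "y = Complex (r / sqrt 2) (- r / sqrt 2)"
    using that by (simp add: rot_mult complex_eq_iff flip: add_divide_distrib)
  moreover have "Re y + Im y = 0 \<and> Re y - Im y = r * sqrt 2" if "rot * y = of_real r"
    using that by (auto simp: rot_mult complex_eq_iff divide_eq_eq)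
  ultimately show ?thesis
    by blast
qed

lemma norm_rot [simp]: "norm rot = 1"
  by (simp add: rot_eq_exp)

lemma rot_mult_notin_nonpos_Reals:
  assumes "Im y < 0"
  shows "rot * y \<notin> \<real>\<^sub>\<le>\<^sub>0"
proof
  assume "rot * y \<in> \<real>\<^sub>\<le>\<^sub>0"
  then obtain r where "rot * y = of_real r" "r \<le> 0"
    by (elim nonpos_Reals_cases)
  then show False
    using assms by (auto simp: rot_mult_eq_of_real_iff zero_less_divide_iff)
qed

lemma aux_integrand_denominator_eq_0_iff:
  "exp (of_real pi * \<i> * x) - exp (- (of_real pi * \<i> * x)) = 0 \<longleftrightarrow> (\<exists>n::int. x = of_int n)"
proof -
  have "exp (of_real pi * \<i> * x) - exp (- (of_real pi * \<i> * x)) = 2 * \<i> * sin (of_real pi * x)"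
    by (simp add: sin_exp_eq mult_ac)
  also have "\<dots> = 0 \<longleftrightarrow> (\<exists>n::int. of_real pi * x = of_real (of_int n * pi))"
    by (simp add: Complex_Transcendental.sin_eq_0)
  also have "\<dots> \<longleftrightarrow> (\<exists>n::int. x = of_int n)"
    by (simp add: mult.commute)
  finally show ?thesis .
qed

text \<open>The integrand in the coordinate $y = e^{-\pi i/4} x$, in which the lines of integration become
  horizontal, so that the residue theorem can be applied on rectangles.\<close>

definition rot_integrand :: "complex \<Rightarrow> complex \<Rightarrow> complex" where
  "rot_integrand s y = aux_integrand s (rot * y) * rot"

lemma holomorphic_rot_integrand:
  "rot_integrand s holomorphic_on {y. Im y < 0} - {y. \<exists>n::int. rot * y = of_int n}"
  unfolding rot_integrand_def aux_integrand_def
  by (intro holomorphic_intros) (auto simp: aux_integrand_denominator_eq_0_iff rot_mult_notin_nonpos_Reals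
       simp del: right_minus_eq)

text \<open>A simple pole, with residue numerator over derivative of the denominator. The sign
  (-1)^n of the derivative cancels exp (pi i n^2), as n^2 and n have the same parity, and its factor
  \<open>rot\<close> cancels the Jacobian.\<close>

lemma residue_rot_integrand:
  fixes n :: nat
  assumes "n > 0"
  defines "p \<equiv> Complex (real n / sqrt 2) (- real n / sqrt 2)"
  shows "2 * pi * \<i> * residue (rot_integrand s) p = of_nat n powr (- s)"
proof -
  define f where "f y = (rot * y) powr (- s) * exp (of_real pi * \<i> * (rot * y)\<^sup>2) * rot" for y
  define g where "g y = exp (of_real pi * \<i> * (rot * y)) - exp (- (of_real pi * \<i> * (rot * y)))" for y
  have p: "rot * p = of_nat n"
    using rot_mult_eq_of_real_iff[of p "real n"] by (simp add: p_def)
  have Im_p: "Im p < 0"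
    using assms by simp
  have rot0: "rot \<noteq> 0"
    using norm_rot by force
  have e: "exp (of_real pi * \<i> * of_nat m) = (-1) ^ m" for m
  proof -
    have "exp (of_real pi * \<i> * of_nat m) = exp (of_nat m * (of_real pi * \<i>))"
      by (simp add: mult_ac)
    then show ?thesis
      by (simp only: exp_of_nat_mult exp_pi_i)
  qed
  have "(-1) ^ n * exp (- (of_real pi * \<i> * of_nat n)) = 1"
    unfolding e[symmetric] by (simp flip: exp_add)
  then have e': "exp (- (of_real pi * \<i> * of_nat n)) = (-1) ^ n"
    by (cases "even n") (auto, metis minus_minus)
  have "of_real pi * \<i> * (of_nat n)\<^sup>2 = of_real pi * \<i> * of_nat (n\<^sup>2)"
    by simp
  then have e2: "exp (of_real pi * \<i> * (of_nat n)\<^sup>2) = (-1) ^ n"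
    by (simp only: e) (cases "even n"; simp)
  have "residue (\<lambda>y. f y / g y) p = f p / (2 * pi * \<i> * rot * (-1) ^ n)"
  proof (rule residue_simple_pole_deriv)
    show "f holomorphic_on {y. Im y < 0}"
      unfolding f_def by (intro holomorphic_intros) (auto simp: rot_mult_notin_nonpos_Reals)
    show "g holomorphic_on {y. Im y < 0}"
      unfolding g_def by (intro holomorphic_intros)
    show "connected {y. Im y < 0}"
      by (intro convex_connected convex_halfspace_Im_lt)
    show "(g has_field_derivative 2 * pi * \<i> * rot * (-1) ^ n) (at p)"
      unfolding g_def
      by (rule derivative_eq_intros refl)+ (simp add: p e[simplified] e'[simplified])
    show "f p \<noteq> 0"
      unfolding f_def p using assms(1) rot0 by simp
    show "g p = 0"
      by (simp add: g_def p e[simplified] e'[simplified])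
  qed (use Im_p rot0 open_halfspace_Im_lt in auto)
  also have "(\<lambda>y. f y / g y) = rot_integrand s"
    by (simp add: fun_eq_iff f_def g_def rot_integrand_def aux_integrand_def)
  also have "f p / (2 * pi * \<i> * rot * (-1) ^ n) = of_nat n powr (- s) / (2 * pi * \<i>)"
    using rot0 by (simp add: f_def p e2)
  finally show ?thesis
    by simp
qed

text \<open>Here |exp (pi i X^2)| = exp (pi (y^2 - x^2)). The threshold on |x| forces |Im X| \<ge>
  1, so the two exponentials of the denominator differ in modulus by at least 1. Uniformity in y
  serves the vertical sides; a single y gives integrability.\<close>

lemma norm_rot_integrand_le:
  assumes "Re s \<ge> 0" and y: "- b / sqrt 2 \<le> y" "y \<le> - c / sqrt 2" and "0 < c"
    and x: "\<bar>x\<bar> \<ge> b / sqrt 2 + sqrt 2"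
  shows "norm (rot_integrand s (Complex x y)) \<le>
    (c / sqrt 2) powr (- Re s) * exp (\<bar>Im s\<bar> * pi + pi * (b / sqrt 2)\<^sup>2) * exp (- (pi * x\<^sup>2))"
proof -
  define X where "X = rot * Complex x y"
  have X: "Re X = (x - y) / sqrt 2" "Im X = (x + y) / sqrt 2"
    by (simp_all add: X_def rot_mult)
  have "c / sqrt 2 \<le> \<bar>y\<bar>"
    using y \<open>0 < c\<close> by (simp add: abs_if)
  also have "\<dots> \<le> norm X"
    using abs_Im_le_cmod[of "Complex x y"] by (simp add: X_def norm_mult)
  finally have norm_X: "c / sqrt 2 \<le> norm X" .
  moreover have "0 < c / sqrt 2"
    using \<open>0 < c\<close> by simp
  ultimately have "norm X > 0"
    by linarith
  then have X0: "X \<noteq> 0" by auto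
  have y_abs: "\<bar>y\<bar> \<le> b / sqrt 2"
    using y \<open>0 < c / sqrt 2\<close> by (auto simp: abs_le_iff)
  have pw: "norm X powr (- Re s) \<le> (c / sqrt 2) powr (- Re s)"
    using norm_X \<open>0 < c / sqrt 2\<close> \<open>Re s \<ge> 0\<close> by (intro powr_mono2') auto
  have "Im s * Im (Ln X) \<le> \<bar>Im s\<bar> * pi"
  proof -
    have "\<bar>Im (Ln X)\<bar> \<le> pi"
      using mpi_less_Im_Ln[OF X0] Im_Ln_le_pi[OF X0] by simp
    then have "\<bar>Im s * Im (Ln X)\<bar> \<le> \<bar>Im s\<bar> * pi"
      unfolding abs_mult by (intro mult_left_mono) auto
    then show ?thesis by simp
  qed
  moreover have "- 2 * pi * Re X * Im X \<le> pi * (b / sqrt 2)\<^sup>2 - pi * x\<^sup>2"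
  proof -
    have "- 2 * pi * Re X * Im X = pi * y\<^sup>2 - pi * x\<^sup>2"
      unfolding X by (simp add: field_simps power2_eq_square)
    moreover have "y\<^sup>2 \<le> (b / sqrt 2)\<^sup>2"
      using power_mono[OF y_abs, of 2] by simp
    ultimately show ?thesis
      by (simp add: mult_left_mono)
  qed
  ultimately have ex: "exp (Im s * Im (Ln X) - 2 * pi * Re X * Im X) \<le>
      exp (\<bar>Im s\<bar> * pi + pi * (b / sqrt 2)\<^sup>2 - pi * x\<^sup>2)"
    by simp
  have "1 \<le> \<bar>Im X\<bar>"
  proof -
    have "sqrt 2 \<le> \<bar>x + y\<bar>"
      using x y_abs by (simp add: abs_if split: if_splits)
    then show ?thesis
      by (simp add: X abs_divide)
  qed
  then have I: "1 \<le> \<bar>pi * Im X\<bar>"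
    using pi_ge_two mult_mono[of 1 pi 1 "\<bar>Im X\<bar>"] by (simp add: abs_mult)
  have den: "1 \<le> norm (exp (of_real pi * \<i> * X) - exp (- (of_real pi * \<i> * X)))"
  proof -
    have "1 \<le> \<bar>exp k - exp (- k)\<bar>" if "1 \<le> \<bar>k\<bar>" for k :: real
    proof -
      have *: "1 \<le> exp k - exp (- k)" if "1 \<le> k" for k :: real
        using exp_ge_add_one_self[of k] exp_le_one_iff[of "- k"] that by linarith
      show ?thesis
        using *[of k] *[of "- k"] that by (cases "k \<ge> 0") auto
    qed
    from this[OF I] have "1 \<le> \<bar>exp (- (pi * Im X)) - exp (pi * Im X)\<bar>"
      by (simp add: abs_minus_commute)
    also have "\<dots> = \<bar>norm (exp (of_real pi * \<i> * X)) - norm (exp (- (of_real pi * \<i> * X)))\<bar>"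
      by (simp add: norm_exp_eq_Re)
    also have "\<dots> \<le> norm (exp (of_real pi * \<i> * X) - exp (- (of_real pi * \<i> * X)))"
      by (rule norm_triangle_ineq3)
    finally show ?thesis .
  qed
  have "norm (rot_integrand s (Complex x y)) =
    norm X powr (- Re s) * exp (Im s * Im (Ln X) - 2 * pi * Re X * Im X) /
      norm (exp (of_real pi * \<i> * X) - exp (- (of_real pi * \<i> * X)))"
    by (simp add: rot_integrand_def norm_mult norm_aux_integrand[OF X0] flip: X_def)
  also have "\<dots> \<le> (c / sqrt 2) powr (- Re s) * exp (\<bar>Im s\<bar> * pi + pi * (b / sqrt 2)\<^sup>2 - pi * x\<^sup>2) / 1"
    using pw ex den by (intro frac_le mult_mono) auto
  also have "\<dots> = (c / sqrt 2) powr (- Re s) * exp (\<bar>Im s\<bar> * pi + pi * (b / sqrt 2)\<^sup>2) * exp (- (pi * x\<^sup>2))"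
    by (simp add: mult.assoc flip: exp_add)
  finally show ?thesis .
qed

lemma integrable_rot_integrand:
  assumes "Re s \<ge> 0" "0 < c" "c \<notin> \<int>"
  shows "integrable lborel (\<lambda>x. rot_integrand s (Complex x (- c / sqrt 2)))"
proof -
  let ?f = "\<lambda>x. rot_integrand s (Complex x (- c / sqrt 2))"
  define C where "C = c / sqrt 2 + sqrt 2"
  define K where "K = (c / sqrt 2) powr (- Re s) * exp (\<bar>Im s\<bar> * pi + pi * (c / sqrt 2)\<^sup>2)"
  have "Complex x (- c / sqrt 2) \<notin> {y. \<exists>n::int. rot * y = of_int n}" for x
  proof -
    have "c = of_int n" if "rot * Complex x (- c / sqrt 2) = of_int n" for n
      using that rot_mult_eq_of_real_iff[of "Complex x (- c / sqrt 2)" "of_int n"]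
      by (simp add: divide_simps)
    then show ?thesis
      using \<open>c \<notin> \<int>\<close> by auto
  qed
  then have cont: "continuous_on UNIV ?f"
    using \<open>0 < c\<close>
    by (intro continuous_on_compose2[OF holomorphic_on_imp_continuous_on[OF holomorphic_rot_integrand]])
       (auto intro!: continuous_intros simp: divide_less_0_iff)
  have "bounded (?f ` {- C..C})"
    by (intro compact_imp_bounded compact_continuous_image continuous_on_subset[OF cont]) auto
  then have "\<exists>K2. \<forall>x\<in>{- C..C}. norm (?f x) \<le> K2"
    by (simp add: bounded_iff)
  then obtain K2 where K2: "\<And>x. x \<in> {- C..C} \<Longrightarrow> norm (?f x) \<le> K2"
    by blast
  show ?thesis
  proof (rule Bochner_Integration.integrable_bound)
    have "integrable lborel (\<lambda>x. exp (0 * x - pi * x\<^sup>2))"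
      using has_bochner_integral_gaussian[of pi 0] by (simp only: has_bochner_integral_iff pi_gt_zero)
    moreover have "integrable lborel (\<lambda>x. indicator {- C..C} x *\<^sub>R K2)"
      by (intro integrable_scaleR_left integrable_real_indicator) (auto simp: emeasure_lborel_Icc_eq)
    ultimately show "integrable lborel (\<lambda>x. K * exp (0 * x - pi * x\<^sup>2) + indicator {- C..C} x *\<^sub>R K2)"
      by (intro Bochner_Integration.integrable_add integrable_mult_right)
    show "?f \<in> borel_measurable lborel"
      using cont by (simp add: borel_measurable_continuous_onI)
    have bound: "norm (?f x) \<le> norm (K * exp (0 * x - pi * x\<^sup>2) + indicator {- C..C} x *\<^sub>R K2)" for x
    proof -
      have K0: "K * exp (- (pi * x\<^sup>2)) \<ge> 0"
        by (simp add: K_def)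
      show ?thesis
      proof (cases "x \<in> {- C..C}")
        case True
        then show ?thesis
          using K2[OF True] K0 by simp
      next
        case False
        then have "\<bar>x\<bar> \<ge> C" by auto
        then have "norm (?f x) \<le> K * exp (- (pi * x\<^sup>2))"
          unfolding K_def C_def using assms
          by (intro norm_rot_integrand_le) auto
        then show ?thesis
          using K0 False by simp
      qed
    qed
    show "AE x in lborel. norm (?f x) \<le> norm (K * exp (0 * x - pi * x\<^sup>2) + indicator {- C..C} x *\<^sub>R K2)"
      by (intro AE_I2 bound)
  qed
qed

text \<open>The point c itself has rotated abscissa c / sqrt 2, which accounts for the translation;
  the minus sign reflects the descending bounds.\<close>

lemma riemann_aux_eq_rot_integrand:
  "riemann_aux c s = - (LINT x|lborel. rot_integrand s (Complex x (- c / sqrt 2)))"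
proof -
  have "riemann_aux c s = - (LINT u|lborel. aux_integrand s (aux_line c u) * rot)"
    by (simp add: riemann_aux_def interval_lebesgue_integral_def einterval_def set_lebesgue_integral_def rot_eq_exp)
  also have "(\<lambda>u. aux_integrand s (aux_line c u) * rot) =
      (\<lambda>u. rot_integrand s (Complex (c / sqrt 2 + 1 * u) (- c / sqrt 2)))"
  proof
    fix u
    have "rot * Complex (c / sqrt 2 + 1 * u) (- c / sqrt 2) = aux_line c u"
      by (simp add: rot_mult aux_line_eq complex_eq_iff add_divide_distrib)
    then show "aux_integrand s (aux_line c u) * rot =
        rot_integrand s (Complex (c / sqrt 2 + 1 * u) (- c / sqrt 2))"
      by (simp only: rot_integrand_def)
  qed
  also have "(LINT u|lborel. rot_integrand s (Complex (c / sqrt 2 + 1 * u) (- c / sqrt 2))) =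
     (LINT x|lborel. rot_integrand s (Complex x (- c / sqrt 2)))"
    by (subst lborel_integral_real_affine[where c = 1 and t = "c / sqrt 2"]) simp_all
  finally show ?thesis .
qed

text \<open>Moving right means lowering the horizontal line in the rotated coordinate. The lower
  minus the upper integral gives the residues, and the minus sign in \<open>riemann_aux\<close>
  turns this into the value at c minus the value at b.\<close>

lemma riemann_aux_shift:
  fixes N :: nat
  assumes "Re s \<ge> 0" "0 < c" "c < 1" "real N < b" "b < real N + 1" "N > 0"
  shows "riemann_aux c s = (\<Sum>n=1..N. of_nat n powr (- s)) + riemann_aux b s"
proof -
  define P where "P = (\<lambda>n. Complex (real n / sqrt 2) (- real n / sqrt 2)) ` {1..N}"
  define C where "C = b / sqrt 2 + sqrt 2"
  define K where "K = (c / sqrt 2) powr (- Re s) * exp (\<bar>Im s\<bar> * pi + pi * (b / sqrt 2)\<^sup>2)"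
  have cb: "c < b"
    using assms by linarith
  have not_int: "c \<notin> \<int>" "b \<notin> \<int>"
  proof -
    have "x \<notin> \<int>" if "real m < x" "x < real m + 1" for x m
    proof
      assume "x \<in> \<int>"
      then obtain k :: int where "x = of_int k"
        by (elim Ints_cases)
      with that have "real_of_int (int m) < of_int k" "of_int k < real_of_int (int m + 1)"
        by simp_all
      then show False
        unfolding of_int_less_iff by simp
    qed
    from this[of 0 c] this[of N b] show "c \<notin> \<int>" "b \<notin> \<int>"
      using assms by auto
  qed
  have "(LINT x|lborel. rot_integrand s (Complex x (- b / sqrt 2))) -
        (LINT x|lborel. rot_integrand s (Complex x (- c / sqrt 2))) =
         2 * pi * \<i> * (\<Sum>p\<in>P. residue (rot_integrand s) p)"
  \<comment> \<open>The open strip ends at the heights of the poles N + 1 and 0, so it contains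
    exactly the poles 1 to N and avoids the cut.\<close>
  proof (rule residue_theorem_horizontal_strip[where e = "\<lambda>x. K * exp (- (pi * x\<^sup>2))"
        and a' = "- (real N + 1) / sqrt 2" and b' = 0 and C = C])
    show "- b / sqrt 2 < - c / sqrt 2" "- (real N + 1) / sqrt 2 < - b / sqrt 2"
      using assms cb by (intro divide_strict_right_mono; simp)+
    show "- c / sqrt 2 < 0"
      using assms by simp
    show "finite P"
      by (simp add: P_def)
    show "- b / sqrt 2 < Im z \<and> Im z < - c / sqrt 2" if "z \<in> P" for z
      using that assms by (auto simp: P_def divide_simps)
    show "rot_integrand s holomorphic_on {z. - (real N + 1) / sqrt 2 < Im z \<and> Im z < 0} - P"
    proof (rule holomorphic_on_subset[OF holomorphic_rot_integrand])
      have "z \<in> P" if z: "- (real N + 1) / sqrt 2 < Im z" "Im z < 0" and "rot * z = of_int n" for z n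
      proof -
        have "z = Complex (of_int n / sqrt 2) (- of_int n / sqrt 2)"
          using that(3) rot_mult_eq_of_real_iff[of z "of_int n"] by simp
        moreover from this have "n > 0" "n < int N + 1"
          using z by (simp_all add: divide_simps)
        ultimately show ?thesis
          unfolding P_def by (intro image_eqI[of _ _ "nat n"]) auto
      qed
      then show "{z. - (real N + 1) / sqrt 2 < Im z \<and> Im z < 0} - P \<subseteq>
          {y. Im y < 0} - {y. \<exists>n::int. rot * y = of_int n}"
        by auto
    qed
    show "norm (rot_integrand s (Complex x y)) \<le> K * exp (- (pi * x\<^sup>2))"
      if "C \<le> \<bar>x\<bar>" "- b / sqrt 2 \<le> y" "y \<le> - c / sqrt 2" for x y
      unfolding K_def using that assms by (intro norm_rot_integrand_le) (auto simp: C_def)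
    show "((\<lambda>x. K * exp (- (pi * x\<^sup>2))) \<longlongrightarrow> 0) at_top"
      by (intro tendsto_mult_right_zero) real_asymp
    show "((\<lambda>x. K * exp (- (pi * x\<^sup>2))) \<longlongrightarrow> 0) at_bot"
      by (intro tendsto_mult_right_zero) real_asymp
  qed (use assms not_int in \<open>auto intro!: integrable_rot_integrand[simplified]\<close>)
  also have "(\<Sum>p\<in>P. residue (rot_integrand s) p) =
      (\<Sum>n=1..N. residue (rot_integrand s) (Complex (real n / sqrt 2) (- real n / sqrt 2)))"
    unfolding P_def by (subst sum.reindex) (auto simp: inj_on_def)
  also have "2 * pi * \<i> * \<dots> = (\<Sum>n=1..N. of_nat n powr (- s))"
    unfolding sum_distrib_left by (intro sum.cong refl residue_rot_integrand) auto
  finally show ?thesis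
    by (simp add: riemann_aux_eq_rot_integrand algebra_simps)
qed

section \<open>The partial sum and the final estimate\<close>

lemma sum_nat_powr_le:
  fixes \<sigma> :: real
  assumes "\<sigma> \<ge> 2"
  shows "(\<Sum>n=2..N. real n powr (- \<sigma>)) \<le> 3 / 2 powr \<sigma>"
proof -
  \<comment> \<open>Equality at M = 2, where 1 = 3 - 2, fixes the constant 3.\<close>
  have telescope: "(\<Sum>n=2..M. 4 / (real n)\<^sup>2) \<le> 3 - 4 / real M" if "M \<ge> 2" for M
    using that
  proof (induction M rule: nat_induct_at_least)
    case base
    show ?case by simp
  next
    case (Suc n)
    then have n: "real n \<ge> 2"
      by simp
    have "4 / (real (Suc n))\<^sup>2 \<le> 4 / (real n * real (Suc n))"
      using n by (intro divide_left_mono) (auto simp: power2_eq_square)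
    also have "\<dots> = 4 / real n - 4 / real (Suc n)"
      using n by (simp add: divide_simps)
    finally have "4 / (real (Suc n))\<^sup>2 \<le> 4 / real n - 4 / real (Suc n)" .
    moreover have "(\<Sum>n=2..Suc n. 4 / (real n)\<^sup>2) = (\<Sum>n=2..n. 4 / (real n)\<^sup>2) + 4 / (real (Suc n))\<^sup>2"
      using Suc.hyps by (simp add: sum.nat_ivl_Suc' add.commute)
    ultimately show ?case
      using Suc.IH by linarith
  qed
  have bound: "(\<Sum>n=2..N. 4 / (real n)\<^sup>2) \<le> 3"
  proof (cases "N \<ge> 2")
    case True
    have "4 / real N \<ge> 0" by simp
    with telescope[OF True] show ?thesis by linarith
  qed simp
  \<comment> \<open>With 2^(-\<sigma>) taken out, the base n / 2 is at least 1, so \<sigma> may be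
    lowered to 2.\<close>
  have "real n powr (- \<sigma>) \<le> 2 powr (- \<sigma>) * (4 / (real n)\<^sup>2)" if "n \<ge> 2" for n
  proof -
    have "real n powr (- \<sigma>) = (2 * (real n / 2)) powr (- \<sigma>)"
      by simp
    also have "\<dots> = 2 powr (- \<sigma>) * (real n / 2) powr (- \<sigma>)"
      by (rule powr_mult)
    also have "(real n / 2) powr (- \<sigma>) \<le> (real n / 2) powr (- 2)"
      using that assms by (intro powr_mono) auto
    also have "(real n / 2) powr (- 2) = 4 / (real n)\<^sup>2"
      using that by (simp add: powr_minus powr_numeral power_divide)
    finally show ?thesis
      by simp
  qed
  then have "(\<Sum>n=2..N. real n powr (- \<sigma>)) \<le> (\<Sum>n=2..N. 2 powr (- \<sigma>) * (4 / (real n)\<^sup>2))"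
    by (intro sum_mono) auto
  also have "\<dots> = 2 powr (- \<sigma>) * (\<Sum>n=2..N. 4 / (real n)\<^sup>2)"
    by (rule sum_distrib_left[symmetric])
  also have "\<dots> \<le> 2 powr (- \<sigma>) * 3"
    using bound by (intro mult_left_mono) auto
  finally show ?thesis
    by (simp add: powr_minus divide_inverse mult_ac)
qed

theorem proposition11:
  fixes c \<sigma> t :: real and s :: complex
  assumes "0 < c" and "c < 1"
    and "s = of_real \<sigma> + \<i> * of_real t"
    and "\<sigma> \<ge> 2" and "t > 16 * pi"
  shows "norm (riemann_aux c s - 1) \<le>
           3 / 2 powr \<sigma> + (2 * pi / t) powr (min \<sigma> 1 / 2)"
proof -
  define \<xi> where "\<xi> = sqrt (t / (2 * pi))"
  define N where "N = nat \<lfloor>\<xi>\<rfloor>"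
  define b where "b = real N + 1 / 2"
  have "t > 0"
    using assms(5) pi_gt_zero by linarith
  have t: "t = 2 * pi * \<xi>\<^sup>2"
    using \<open>t > 0\<close> by (simp add: \<xi>_def)
  have s: "s = Complex \<sigma> (2 * pi * \<xi>\<^sup>2)"
    using assms(3) unfolding t[symmetric] by (simp add: complex_eq_iff)
  \<comment> \<open>t / (2 pi) exceeds 8 and 2.8^2 = 7.84. What matters is 2.8 > 5/2: N = 2 then
    forces b < \<xi>.\<close>
  have "2.8\<^sup>2 * (2 * pi) < t"
    using assms(5) pi_gt_zero unfolding power2_eq_square by linarith
  then have "\<xi> > 2.8"
    unfolding \<xi>_def by (intro real_less_rsqrt) (simp only: pos_less_divide_eq pi_gt_zero zero_less_mult_iff zero_less_numeral simp_thms)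
  then have N: "real N \<le> \<xi>" "\<xi> < real N + 1" "N \<ge> 2"
    unfolding N_def by linarith+
  have "norm (riemann_aux b s) \<le> 1 / \<xi>"
  proof (cases "b \<le> \<xi>")
    case True
    then show ?thesis
      unfolding s using N assms(4) by (intro norm_riemann_aux_half_integer_le_right[OF N(3)]) (auto simp: b_def)
  next
    case False
    then have "N \<ge> 3"
      using N \<open>\<xi> > 2.8\<close> by (cases "N = 2") (auto simp: b_def)
    then show ?thesis
      unfolding s using False N assms(4) by (intro norm_riemann_aux_half_integer_le_left) (auto simp: b_def)
  qed
  also have "1 / \<xi> = (2 * pi / t) powr (min \<sigma> 1 / 2)"
    using \<open>t > 0\<close> assms(4) by (simp add: \<xi>_def powr_half_sqrt real_sqrt_divide)
  finally have rem: "norm (riemann_aux b s) \<le> (2 * pi / t) powr (min \<sigma> 1 / 2)" .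
  have "riemann_aux c s = (\<Sum>n=1..N. of_nat n powr (- s)) + riemann_aux b s"
    using assms N by (intro riemann_aux_shift) (auto simp: b_def)
  also have "(\<Sum>n=1..N. of_nat n powr (- s)) = 1 + (\<Sum>n=2..N. of_nat n powr (- s))"
    using N by (subst sum.atLeast_Suc_atMost) (auto simp: numeral_2_eq_2)
  finally have "norm (riemann_aux c s - 1) \<le>
      norm (\<Sum>n=2..N. of_nat n powr (- s)) + norm (riemann_aux b s)"
    using norm_triangle_ineq by (simp add: add.assoc)
  also have "norm (\<Sum>n=2..N. of_nat n powr (- s)) \<le> (\<Sum>n=2..N. real n powr (- \<sigma>))"
  proof (rule sum_norm_le)
    fix n assume "n \<in> {2..N}"
    then show "norm (of_nat n powr (- s)) \<le> real n powr (- \<sigma>)"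
      by (subst norm_powr_minus_complex) (auto simp: s)
  qed
  also have "\<dots> \<le> 3 / 2 powr \<sigma>"
    by (rule sum_nat_powr_le[OF assms(4)])
  finally show ?thesis
    using rem by simp
qed

end
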